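(* Let $q=p^s$ be a prime power, $m\ge 1$ an integer, $r=q^m$, and let $e$ be a positive divisor of $q-1$ with $\gcd(e,m)=1$. Then $C_q(m,e)$ is a code over $R=\mathbb{F}_q+u\mathbb{F}_q$ of length $\frac{r^2-r}{e}$ and size $r^2$, and its Lee weight enumerator is $$A_{C_q(m,e)}(z)=1+(r^2-r)\,z^{2\frac{q-1}{eq}(r^2-r)}+(r-1)\,z^{2\frac{q-1}{eq}r^2}.$$ In particular, $C_q(m,e)$ is a two-weight code (with respect to the Lee weight).
   Context: Let $p$ be a prime, $q=p^s$, $r=q^m$ with $s,m\ge1$. Let $R=\mathbb{F}_q+u\mathbb{F}_q$ and $\mathcal{R}=\mathbb{F}_r+u\mathbb{F}_r$, where $u^2=0$. The trace $Tr:\mathcal{R}\to R$ is $Tr(a+ub)=Tr_{r/q}(a)+u\,Tr_{r/q}(b)$ for $a,b\in\mathbb{F}_r$, where $Tr_{r/q}$ is the trace function from $\mathbb{F}_r$ to $\mathbb{F}_q$. Let $\alpha$ be a generator of $\mathbb{F}_r^*$. For a positive divisor $e$ of $q-1$, let $C_0^{(e,r)}=\langle\alpha^e\rangle$ be the subgroup of $\mathbb{F}_r^*$ generated by $\alpha^e$, and let $L=C_0^{(e,r)}+u\mathbb{F}_r=\{t+ut' : t\in C_0^{(e,r)},\ t'\in\mathbb{F}_r\}\subseteq\mathcal{R}^*$, so $n:=|L|=\frac{r^2-r}{e}$. For $a\in\mathcal{R}$ put $ev(a)=(Tr(ax))_{x\in L}\in R^n$. The trace code is $C_q(m,e)=\{ev(a)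 : a\in\mathcal{R}\}\subseteq R^n$. The Gray map is $\phi:R^n\to\mathbb{F}_q^{2n}$, $\phi(\mathbf{a}+u\mathbf{b})=(\mathbf{b},\mathbf{a}+\mathbf{b})$ for $\mathbf a,\mathbf b\in\mathbb{F}_q^n$. The Lee weight of $\mathbf{x}\in R^n$ is the Hamming weight of its Gray image: $w_L(\mathbf{a}+u\mathbf{b})=w_H(\mathbf{b})+w_H(\mathbf{a}+\mathbf{b})$. The Lee weight enumerator of a code $C\subseteq R^n$ is $A_C(z)=\sum_{c\in C}z^{w_L(c)}$. A code is a $t$-weight code if exactly $t$ distinct values occur as weights of its nonzero codewords. *)

theory Defs
  imports Complex_Main "HOL-Library.FuncSet" "HOL-Computational_Algebra.Polynomial"
begin

text \<open>The chain ring \<open>F + u F\<close> with \<open>u\<^sup>2 = 0\<close>: \<open>Dual a b\<close> stands for \<open>a + u b\<close>.\<close>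

datatype 'a dual = Dual (re: 'a) (eps: 'a)

instantiation dual :: (comm_ring_1) comm_ring_1
begin

definition zero_dual :: "'a dual" where "0 = Dual 0 0"
definition one_dual :: "'a dual" where "1 = Dual 1 0"
definition plus_dual :: "'a dual \<Rightarrow> 'a dual \<Rightarrow> 'a dual"
  where "x + y = Dual (re x + re y) (eps x + eps y)"
definition uminus_dual :: "'a dual \<Rightarrow> 'a dual"
  where "- x = Dual (- re x) (- eps x)"
definition minus_dual :: "'a dual \<Rightarrow> 'a dual \<Rightarrow> 'a dual"
  where "x - y = Dual (re x - re y) (eps x - eps y)"
definition times_dual :: "'a dual \<Rightarrow> 'a dual \<Rightarrow> 'a dual"
  where "x * y = Dual (re x * re y) (re x * eps y + eps x * re y)"

instance
  by standard
    (auto simp: zero_dual_def one_dual_def plus_dual_def uminus_dual_def minus_dual_def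
      times_dual_def algebra_simps)

end

instance dual :: (finite) finite
proof
  have "(UNIV :: 'a dual set) = (\<lambda>(a, b). Dual a b) ` UNIV"
    by (auto simp: image_iff) (metis dual.exhaust)
  then show "finite (UNIV :: 'a dual set)"
    by (metis finite finite_imageI)
qed

definition dual_u :: "'a::comm_ring_1 dual" where "dual_u = Dual 0 1"

lemma dual_u_squared: "(dual_u :: 'a::comm_ring_1 dual)\<^sup>2 = 0"
  by (simp add: power2_eq_square dual_u_def times_dual_def zero_dual_def)

lemma Dual_eq: "Dual a b = Dual a 0 + dual_u * Dual b (0 :: 'a::comm_ring_1)"
  by (simp add: dual_u_def times_dual_def plus_dual_def)

definition is_subfield :: "'a::field set \<Rightarrow> bool" where
  "is_subfield K \<longleftrightarrow> 0 \<in> K \<and> 1 \<in> K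
     \<and> (\<forall>x\<in>K. \<forall>y\<in>K. x + y \<in> K \<and> x * y \<in> K)
     \<and> (\<forall>x\<in>K. - x \<in> K \<and> inverse x \<in> K)"

text \<open>\<open>K + u K\<close> as a subset of \<open>F + u F\<close>.\<close>

definition dual_over :: "'a set \<Rightarrow> 'a dual set" where
  "dual_over K = {Dual a b | a b. a \<in> K \<and> b \<in> K}"

text \<open>The relative trace from the field with \<open>q ^ m\<close> elements to the subfield with \<open>q\<close>
  elements is \<open>x + x\<^sup>q + \<dots> + x^(q^(m-1))\<close>.\<close>

definition field_trace :: "nat \<Rightarrow> nat \<Rightarrow> 'a::field \<Rightarrow> 'a" where
  "field_trace q m x = (\<Sum>i<m. x ^ (q ^ i))"

definition dual_trace :: "nat \<Rightarrow> nat \<Rightarrow> 'a::field dual \<Rightarrow> 'a dual" where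
  "dual_trace q m x = Dual (field_trace q m (re x)) (field_trace q m (eps x))"

text \<open>The subgroup of the multiplicative group generated by a nonzero \<open>g\<close>.\<close>

definition mult_gen :: "'a::field \<Rightarrow> 'a set" where
  "mult_gen g = range (\<lambda>k::int. g powi k)"

definition defining_set :: "'a::field \<Rightarrow> nat \<Rightarrow> 'a dual set" where
  "defining_set \<alpha> e = {Dual t t' | t t'. t \<in> mult_gen (\<alpha> ^ e)}"

text \<open>Vectors of length \<open>n\<close> over an alphabet \<open>A\<close> are the extensional functions \<open>I \<rightarrow>\<^sub>E A\<close>
  on an index set \<open>I\<close> with \<open>n\<close> elements; the codewords below are indexed by
  \<open>I = defining_set \<alpha> e\<close>.\<close>

definition ev :: "nat \<Rightarrow> nat \<Rightarrow> 'a::field dual set \<Rightarrow> 'a dual \<Rightarrow> ('a dual \<Rightarrow> 'a dual)" where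
  "ev q m L a = (\<lambda>x\<in>L. dual_trace q m (a * x))"

definition trace_code :: "'a::field \<Rightarrow> nat \<Rightarrow> nat \<Rightarrow> nat \<Rightarrow> ('a dual \<Rightarrow> 'a dual) set" where
  "trace_code \<alpha> q m e = range (ev q m (defining_set \<alpha> e))"

text \<open>The \<open>2n\<close> coordinates of the Gray image are indexed by the disjoint sum \<open>I <+> I\<close>:
  the left copy carries \<open>b\<close> and the right copy carries \<open>a + b\<close>.\<close>

definition gray :: "'i set \<Rightarrow> ('i \<Rightarrow> 'a::field dual) \<Rightarrow> ('i + 'i \<Rightarrow> 'a)" where
  "gray I c = restrict (case_sum (\<lambda>i. eps (c i)) (\<lambda>i. re (c i) + eps (c i))) (I <+> I)"

definition hamming_weight :: "'i set \<Rightarrow> ('i \<Rightarrow> 'a::zero) \<Rightarrow> nat" where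
  "hamming_weight I v = card {i \<in> I. v i \<noteq> 0}"

definition lee_weight :: "'i set \<Rightarrow> ('i \<Rightarrow> 'a::field dual) \<Rightarrow> nat" where
  "lee_weight I c = hamming_weight (I <+> I) (gray I c)"

definition lee_weight_enumerator :: "'i set \<Rightarrow> ('i \<Rightarrow> 'a::field dual) set \<Rightarrow> int poly" where
  "lee_weight_enumerator I C = (\<Sum>c\<in>C. monom 1 (lee_weight I c))"

definition lee_t_weight_code :: "nat \<Rightarrow> 'i set \<Rightarrow> ('i \<Rightarrow> 'a::field dual) set \<Rightarrow> bool" where
  "lee_t_weight_code t I C \<longleftrightarrow> card (lee_weight I ` (C - {\<lambda>i\<in>I. 0})) = t"

end

theory Submission
  imports Defs "HOL-Number_Theory.Cong"
begin

text \<open>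
  If \<open>a = a\<^sub>0 + u b\<^sub>0\<close> with \<open>a\<^sub>0 \<noteq> 0\<close>, then for each fixed \<open>t\<close> the components of \<open>a (t + u t')\<close> that
  enter the Gray image are affine bijections in \<open>t'\<close>, so each half of the Gray image has
  \<open>|C\<^sub>0| (r - r/q)\<close> nonzero entries. If \<open>a\<^sub>0 = 0\<close>, both halves reduce to the values
  \<open>Tr (b\<^sub>0 t)\<close> with \<open>t \<in> C\<^sub>0\<close>. Since \<open>(r - 1)/(q - 1) \<equiv> m\<close> modulo \<open>e\<close> is coprime to \<open>e\<close>, powers of
  \<open>\<alpha>\<^bsup>(r-1)/(q-1)\<^esup> \<in> K\<close> represent all cosets of \<open>C\<^sub>0\<close>; the trace is \<open>K\<close>-linear, so its nonzero values
  are equally distributed over the cosets and \<open>C\<^sub>0\<close> receives the fraction \<open>1/e\<close> of them.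
\<close>

section \<open>Finite fields: powers, characteristic, trace fibres, orders of generators\<close>

text \<open>Multiplication by a nonzero \<open>x\<close> permutes \<open>K - {0}\<close>, so the
  product of all nonzero elements absorbs the factor \<open>x ^ (card K - 1)\<close>.\<close>

lemma subfield_power_card:
  fixes K :: "'a::{field,finite} set"
  assumes "is_subfield K" and "x \<in> K"
  shows "x ^ card K = x"
proof (cases "x = 0")
  case True
  with assms show ?thesis by (auto simp: power_0_left)
next
  case False
  have K: "y * z \<in> K" "inverse y \<in> K" "0 \<in> K" if "y \<in> K" "z \<in> K" for y z
    using assms(1) that by (auto simp: is_subfield_def)
  have "(\<Prod>y\<in>K-{0}. x * y) = (\<Prod>y\<in>K-{0}. y)"
    by (rule prod.reindex_bij_witness[of _ "\<lambda>y. inverse x * y" "\<lambda>y. x * y"])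
      (use False assms(2) K in \<open>auto simp flip: mult.assoc\<close>)
  then have "x ^ card (K - {0}) * \<Prod>(K-{0}) = 1 * \<Prod>(K-{0})"
    by (simp add: prod.distrib)
  then have "x ^ card (K - {0}) = 1"
    by (subst (asm) mult_right_cancel) auto
  moreover have "card K = Suc (card (K - {0}))"
    using K(3)[OF assms(2) assms(2)] by (metis card.remove finite)
  ultimately show ?thesis by simp
qed

text \<open>Translation by 1 permutes the field; comparing the sums of all elements gives
  \<open>p ^ k = 0\<close> in the field, so the prime characteristic divides
  \<open>p ^ k\<close>.\<close>

lemma CHAR_eq_prime_of_card:
  assumes "prime p" and "card (UNIV :: 'a::{field,finite} set) = p ^ k"
  shows "CHAR('a) = p"
proof -
  have "prime CHAR('a)"
    by (simp add: finite_imp_CHAR_pos prime_CHAR_semidom)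
  moreover have "CHAR('a) dvd p ^ k"
  proof -
    have "(\<Sum>x\<in>(UNIV :: 'a set). x + 1) = (\<Sum>x\<in>UNIV. x)"
      by (rule sum.reindex_bij_witness[of _ "\<lambda>x. x - 1" "\<lambda>x. x + 1"]) auto
    then have "of_nat (p ^ k) = (0 :: 'a)"
      by (simp add: sum.distrib assms(2))
    then show ?thesis
      by (simp only: of_nat_eq_0_iff_char_dvd)
  qed
  ultimately show ?thesis
    by (meson assms(1) prime_dvd_power primes_dvd_imp_eq)
qed

text \<open>The fibre over \<open>y\<close> is the root set of a monic polynomial of degree
  \<open>q ^ (m - 1)\<close>.\<close>

lemma card_field_trace_fibre_le:
  fixes y :: "'a::{field,finite}"
  assumes "q \<ge> 2" and "m \<ge> 1"
  shows "card {x. field_trace q m x = y} \<le> q ^ (m - 1)"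
proof -
  define P where "P = (\<Sum>i<m. monom (1::'a) (q ^ i)) - [:y:]"
  have "degree P \<le> q ^ (m - 1)"
    unfolding P_def
    by (intro degree_diff_le degree_sum_le)
      (use assms in \<open>auto intro!: order.trans[OF degree_monom_le] power_increasing\<close>)
  moreover have "coeff P (q ^ (m - 1)) = 1"
  proof -
    \<comment> \<open>The constant \<open>y\<close> has degree 0 and so does not reach the top
      coefficient; \<open>q \<ge> 2\<close> makes the exponents \<open>q ^ i\<close> distinct,
      leaving only \<open>i = m - 1\<close>.\<close>
    have "coeff P (q ^ (m - 1)) = (\<Sum>i<m. if q ^ i = q ^ (m - 1) then 1 else 0)"
      using assms by (simp add: P_def coeff_sum coeff_pCons split: nat.split)
    also have "\<dots> = (\<Sum>i<m. if i = m - 1 then 1 else 0)"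
      by (intro sum.cong) (use assms in auto)
    also have "\<dots> = 1"
      using assms by (subst sum.delta) auto
    finally show ?thesis .
  qed
  moreover from this have "P \<noteq> 0" by auto
  moreover have "poly P x = field_trace q m x - y" for x
    by (simp add: P_def field_trace_def poly_sum poly_monom)
  ultimately show ?thesis
    using card_poly_roots_bound[of P] by simp
qed

lemma field_trace_mult_fixed:
  assumes "c ^ q = c"
  shows "field_trace q m (c * x) = c * field_trace q m x"
proof -
  have "c ^ (q ^ i) = c" for i
    by (induction i) (simp_all add: power_mult assms)
  then show ?thesis
    by (simp add: field_trace_def power_mult_distrib sum_distrib_left)
qed

lemma field_trace_0 [simp]: "q > 0 \<Longrightarrow> field_trace q m 0 = 0"
  by (simp add: field_trace_def power_0_left)

text \<open>By Bezout, \<alpha> to the power \<open>g = gcd k N\<close> is 1, so \<alpha> has at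
  most \<open>g\<close> distinct powers. They exhaust all \<open>N\<close> nonzero elements, which
  forces \<open>g = N\<close>.\<close>

lemma generator_order_dvd:
  fixes \<alpha> :: "'a::{field,finite}"
  assumes "\<alpha> \<noteq> 0" and gen: "mult_gen \<alpha> = UNIV - {0}" and "\<alpha> powi k = 1"
  shows "int (card (UNIV :: 'a set) - 1) dvd k"
proof -
  define N where "N = card (UNIV :: 'a set) - 1"
  have "is_subfield (UNIV :: 'a set)" by (simp add: is_subfield_def)
  then have "\<alpha> ^ Suc N = \<alpha>"
    using subfield_power_card[of UNIV \<alpha>] by (simp add: N_def finite_UNIV_card_ge_0)
  with assms have N: "\<alpha> powi int N = 1" by simp
  have "card {0, 1 :: 'a} \<le> card (UNIV :: 'a set)"
    by (rule card_mono) auto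
  then have "N > 0" by (simp add: N_def)
  define g where "g = gcd k (int N)"
  have "g > 0" using \<open>N > 0\<close> by (simp add: g_def)
  obtain u v where "u * k + v * int N = g"
    unfolding g_def using bezout_int by blast
  then have "\<alpha> powi g = \<alpha> powi (k * u) * \<alpha> powi (int N * v)"
    using assms(1) by (simp flip: power_int_add add: algebra_simps)
  then have g1: "\<alpha> powi g = 1"
    using assms(3) N by (simp add: power_int_mult)
  have "UNIV - {0} \<subseteq> (\<lambda>i. \<alpha> powi i) ` {0..<g}"
  proof
    fix x assume "x \<in> UNIV - {0 :: 'a}"
    then obtain j where "x = \<alpha> powi j"
      using gen by (auto simp: mult_gen_def)
    also have "\<alpha> powi j = \<alpha> powi (g * (j div g) + j mod g)" by simp
    also have "\<dots> = \<alpha> powi (j mod g)"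
      using assms(1) g1 by (subst power_int_add) (simp_all add: power_int_mult)
    finally show "x \<in> (\<lambda>i. \<alpha> powi i) ` {0..<g}"
      using \<open>g > 0\<close> by auto
  qed
  then have "N \<le> nat g"
    using surj_card_le[of "{0..<g}" "UNIV - {0}" "\<lambda>i. \<alpha> powi i"]
    by (simp add: N_def card_Diff_singleton)
  moreover have "g dvd int N" "g dvd k" by (simp_all add: g_def)
  moreover have "g \<le> int N"
    using \<open>g dvd int N\<close> \<open>N > 0\<close> by (simp add: zdvd_imp_le)
  ultimately have "g = int N" using \<open>g > 0\<close> by linarith
  with \<open>g dvd k\<close> show ?thesis unfolding N_def by (simp only:)
qed

section \<open>Counting over the defining set and in the Gray image\<close>

lemma card_defining_set_Collect:
  fixes \<alpha> :: "'a::{field,finite}"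
  shows "card {x \<in> defining_set \<alpha> e. P (re x) (eps x)}
    = (\<Sum>t\<in>mult_gen (\<alpha> ^ e). card {t'. P t t'})"
proof -
  have "bij_betw (\<lambda>(t, t'). Dual t t') (SIGMA t:mult_gen (\<alpha> ^ e). {t'. P t t'})
      {x \<in> defining_set \<alpha> e. P (re x) (eps x)}"
    by (rule bij_betw_byWitness[where f' = "\<lambda>x. (re x, eps x)"])
      (auto simp: defining_set_def)
  from bij_betw_same_card[OF this] show ?thesis by simp
qed

lemma lee_weight_eq:
  fixes c :: "'i \<Rightarrow> 'a::field dual"
  assumes "finite I"
  shows "lee_weight I c
    = card {i \<in> I. eps (c i) \<noteq> 0} + card {i \<in> I. re (c i) + eps (c i) \<noteq> 0}"
proof -
  have "{i \<in> I <+> I. gray I c i \<noteq> 0}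
      = {i \<in> I. eps (c i) \<noteq> 0} <+> {i \<in> I. re (c i) + eps (c i) \<noteq> 0}"
    by (auto simp: gray_def)
  then show ?thesis
    using assms by (simp add: lee_weight_def hamming_weight_def card_Plus)
qed

section \<open>The trace onto the subfield \<open>K\<close>\<close>

locale trace_code_setting =
  fixes \<alpha> :: "'a::{field,finite}" and K :: "'a set" and p s q m r e :: nat
  assumes prime_p: "prime p" and s: "s \<ge> 1" and q: "q = p ^ s"
    and m: "m \<ge> 1" and r: "r = q ^ m"
    and card_UNIV: "card (UNIV :: 'a set) = r"
    and K: "is_subfield K" and card_K: "card K = q"
    and \<alpha>: "\<alpha> \<noteq> 0" and gen: "mult_gen \<alpha> = UNIV - {0}"
    and e: "e > 0" and e_dvd: "e dvd q - 1" and gcd_e: "gcd e m = 1"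
begin

abbreviation T :: "'a \<Rightarrow> 'a" where "T \<equiv> field_trace q m"
abbreviation C0 :: "'a set" where "C0 \<equiv> mult_gen (\<alpha> ^ e)"
abbreviation L :: "'a dual set" where "L \<equiv> defining_set \<alpha> e"
text \<open>This is \<open>r - r/q\<close>, the number of field elements with nonzero trace.\<close>

abbreviation nz :: nat where "nz \<equiv> (q - 1) * q ^ (m - 1)"

lemma q_ge_2: "q \<ge> 2"
proof -
  have "p ^ 1 \<le> p ^ s"
    using s prime_p by (intro power_increasing) (auto dest: prime_ge_1_nat)
  with prime_ge_2_nat[OF prime_p] show ?thesis by (simp add: q)
qed

lemma r_eq: "r = q * q ^ (m - 1)"
  using m by (simp add: r flip: power_Suc)

lemma r_ge_2: "r \<ge> 2"
proof -
  have "q ^ 1 \<le> q ^ m"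
    using m q_ge_2 by (intro power_increasing) auto
  with q_ge_2 show ?thesis by (simp add: r)
qed

lemma CHAR_p: "CHAR('a) = p"
  by (rule CHAR_eq_prime_of_card[OF prime_p, of "s * m"])
    (simp add: card_UNIV r q power_mult)

lemma power_r: "x ^ r = (x :: 'a)"
  using subfield_power_card[of UNIV x] card_UNIV by (simp add: is_subfield_def)

text \<open>Every element of \<open>K\<close> is a root of \<open>X^q - X\<close>, which has at most
  \<open>q = card K\<close> roots. Membership in \<open>K\<close> thus becomes an equation.\<close>

lemma fixed_field: "x \<in> K \<longleftrightarrow> x ^ q = x"
proof -
  define P where "P = monom (1::'a) q - monom 1 1"
  have "coeff P q = 1" using q_ge_2 by (simp add: P_def)
  then have "P \<noteq> 0" by auto
  moreover have "degree P \<le> q"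
    unfolding P_def using q_ge_2
    by (intro degree_diff_le) (auto intro: order.trans[OF degree_monom_le])
  moreover have "poly P x = x ^ q - x" for x
    by (simp add: P_def poly_monom)
  ultimately have "card {x :: 'a. x ^ q = x} \<le> card K"
    using card_poly_roots_bound[of P] card_K by simp
  moreover have "K \<subseteq> {x. x ^ q = x}"
    using subfield_power_card[OF K] card_K by auto
  ultimately have "K = {x. x ^ q = x}"
    by (intro card_seteq) auto
  then show ?thesis by blast
qed

lemma power_q_power_add: "(x + y :: 'a) ^ (q ^ i) = x ^ (q ^ i) + y ^ (q ^ i)"
  by (rule freshmans_dream'[of _ "s * i"])
    (simp_all add: CHAR_p prime_p q power_mult)

lemma trace_add: "T (x + y) = T x + T y"
  by (simp add: field_trace_def power_q_power_add sum.distrib)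

lemma trace_0 [simp]: "T 0 = 0"
  using q_ge_2 by simp

lemma trace_diff: "T (x - y) = T x - T y"
  using trace_add[of "x - y" y] by simp

text \<open>The \<open>q\<close>-th power map is additive and permutes the summands of the trace
  cyclically.\<close>

lemma trace_in_K: "T x \<in> K"
proof -
  have "T x ^ q = (\<Sum>i<m. (x ^ (q ^ i)) ^ q)"
    unfolding field_trace_def
    by (rule freshmans_dream_sum'[of _ s]) (simp_all add: CHAR_p prime_p q)
  also have "\<dots> = (\<Sum>i<m. x ^ (q ^ Suc i))"
    by (simp add: mult.commute flip: power_mult)
  \<comment> \<open>The shifted sum loses the term \<open>x\<close> and gains
    \<open>x ^ (q ^ m)\<close>, which is \<open>x\<close> again.\<close>
  also have "x ^ (q ^ 0) + \<dots> = (\<Sum>i<m. x ^ (q ^ i)) + x ^ (q ^ m)"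
    using sum.lessThan_Suc_shift[of "\<lambda>i. x ^ (q ^ i)" m] by simp
  then have "(\<Sum>i<m. x ^ (q ^ Suc i)) = T x"
    using power_r[of x] by (simp add: field_trace_def r)
  finally show ?thesis by (simp add: fixed_field)
qed

text \<open>The \<open>q\<close> fibres over \<open>K\<close> partition the field and have at most \<open>r/q\<close> elements each.\<close>
lemma card_trace_kernel: "card {x. T x = 0} = q ^ (m - 1)"
proof (rule ccontr)
  assume "card {x. T x = 0} \<noteq> q ^ (m - 1)"
  then have "card {x. T x = 0} < q ^ (m - 1)"
    using card_field_trace_fibre_le[OF q_ge_2 m, of "0::'a"] by simp
  moreover have "0 \<in> K" using K by (simp add: is_subfield_def)
  ultimately have "(\<Sum>y\<in>K. card {x. T x = y}) < (\<Sum>y\<in>K. q ^ (m - 1))"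
    using card_field_trace_fibre_le[OF q_ge_2 m, where 'a = 'a]
    by (intro sum_strict_mono_ex1) auto
  also have "\<dots> = r" by (simp add: card_K r_eq)
  also have "r = card (\<Union>y\<in>K. {x. T x = y})"
  proof -
    have "(\<Union>y\<in>K. {x. T x = y}) = UNIV"
      using trace_in_K by auto
    then show ?thesis by (simp add: card_UNIV)
  qed
  also have "\<dots> = (\<Sum>y\<in>K. card {x. T x = y})"
    by (rule card_UN_disjoint) auto
  finally show False by simp
qed

lemma card_trace_nonzero: "card {x. T x \<noteq> 0} = nz"
proof -
  have "{x. T x \<noteq> 0} = UNIV - {x. T x = 0}" by auto
  then have "card {x. T x \<noteq> 0} = r - q ^ (m - 1)"
    by (simp add: card_Diff_subset card_trace_kernel card_UNIV)
  then show ?thesis by (simp add: r_eq algebra_simps)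
qed

lemma card_trace_affine_nonzero:
  assumes "a \<noteq> 0"
  shows "card {x. T (a * x + c) \<noteq> 0} = nz"
proof -
  have "bij_betw (\<lambda>x. a * x + c) {x. T (a * x + c) \<noteq> 0} {x. T x \<noteq> 0}"
    by (rule bij_betw_byWitness[where f' = "\<lambda>y. (y - c) / a"]) (use assms in auto)
  then show ?thesis
    using bij_betw_same_card card_trace_nonzero by metis
qed

section \<open>Coset representatives of \<open>C0\<close> inside \<open>K\<close>\<close>

text \<open>The index \<open>(r - 1) / (q - 1)\<close> of the multiplicative group of
  \<open>K\<close>, as a geometric sum that can be reduced modulo \<open>e\<close> term by
  term.\<close>

definition N :: nat where "N = (\<Sum>i<m. q ^ i)"

lemma N_mult: "int N * (int q - 1) = int r - 1"
  using power_diff_1_eq[of "int q" m] by (simp add: N_def r mult.commute)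

lemma e_dvd_q: "int e dvd int q - 1"
  using e_dvd q_ge_2 by (metis int_dvd_int_iff of_nat_1 of_nat_diff one_le_numeral order.trans)

text \<open>Each power of \<open>q\<close> is 1 modulo \<open>e\<close>, so \<open>N\<close> is
  congruent to \<open>m\<close>; here \<open>gcd e m = 1\<close> enters.\<close>

lemma coprime_N_e: "coprime (int N) (int e)"
proof -
  have "[int q = 1] (mod int e)"
    using e_dvd_q by (simp add: cong_iff_dvd_diff)
  then have "[(\<Sum>i<m. int q ^ i) = (\<Sum>i<m. 1 ^ i)] (mod int e)"
    by (intro cong_sum cong_pow)
  then have "[int N = int m] (mod int e)"
    by (simp add: N_def)
  moreover have "coprime (int m) (int e)"
    using gcd_e by (simp add: coprime_iff_gcd_eq_1 gcd.commute)
  ultimately show ?thesis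
    by (metis cong_imp_coprime cong_sym)
qed

text \<open>The relation \<open>N * (q - 1) = r - 1\<close> is used as
  \<open>N * q + 1 = r + N\<close>, together with \<open>\<alpha> ^ r = \<alpha>\<close>.\<close>

lemma alpha_N_in_K: "(\<alpha> ^ N) ^ q = \<alpha> ^ N"
proof -
  have "int (N * q) = int (r + N - 1)"
    using N_mult r_ge_2 by (simp add: algebra_simps of_nat_diff)
  then have "N * q + 1 = r + N" using r_ge_2 by linarith
  then have "\<alpha> ^ (N * q) * \<alpha> = \<alpha> ^ r * \<alpha> ^ N"
    by (metis power_add power_one_right)
  then show ?thesis using \<alpha> power_r by (simp add: power_mult)
qed

lemma e_dvd_r: "int e dvd int r - 1"
  using e_dvd_q N_mult by (metis dvd_mult)

lemma coset_element: "(\<alpha> ^ N) ^ i * (\<alpha> ^ e) powi k = \<alpha> powi (int N * int i + int e * k)"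
proof -
  have "(\<alpha> ^ N) ^ i = \<alpha> powi (int N * int i)"
    by (metis of_nat_mult power_int_of_nat power_mult)
  then show ?thesis by (simp add: power_int_add power_int_power \<alpha>)
qed

text \<open>Exponents of \<alpha> are determined modulo \<open>r - 1\<close>, hence modulo
  \<open>e\<close>, and elements of \<open>C0\<close> contribute multiples of \<open>e\<close>. What
  remains is \<open>N * i\<close> modulo \<open>e\<close>, and \<open>N\<close> is a unit
  there.\<close>

lemma bij_betw_cosets:
  "bij_betw (\<lambda>(i, t). (\<alpha> ^ N) ^ i * t) ({..<e} \<times> C0) (UNIV - {0})"
  unfolding bij_betw_def
proof
  show "inj_on (\<lambda>(i, t). (\<alpha> ^ N) ^ i * t) ({..<e} \<times> C0)"
  proof (rule inj_onI, clarsimp)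
    fix i t j t'
    assume i: "i < e" and j: "j < e" and t: "t \<in> C0" "t' \<in> C0"
      and eq: "(\<alpha> ^ N) ^ i * t = (\<alpha> ^ N) ^ j * t'"
    obtain k l where k: "t = (\<alpha> ^ e) powi k" and l: "t' = (\<alpha> ^ e) powi l"
      using t by (auto simp: mult_gen_def)
    have "\<alpha> powi (int N * int i + int e * k - (int N * int j + int e * l)) = 1"
      using eq \<alpha> by (subst power_int_diff) (simp_all add: k l coset_element)
    then have "int r - 1 dvd int N * int i + int e * k - (int N * int j + int e * l)"
      using generator_order_dvd[OF \<alpha> gen] r_ge_2 by (simp add: card_UNIV of_nat_diff)
    then have "int e dvd int N * (int i - int j) + int e * (k - l)"
      using e_dvd_r dvd_trans by (auto simp: algebra_simps)
    then have "int e dvd int N * (int i - int j)"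
      by (simp add: dvd_add_left_iff)
    then have "int e dvd int i - int j"
      using coprime_N_e by (simp add: coprime_commute coprime_dvd_mult_right_iff)
    then have "[int i = int j] (mod int e)"
      by (simp add: cong_iff_dvd_diff)
    then have "i = j"
      using i j by (simp add: cong_def)
    then show "i = j \<and> t = t'" using eq \<alpha> by simp
  qed
  show "(\<lambda>(i, t). (\<alpha> ^ N) ^ i * t) ` ({..<e} \<times> C0) = UNIV - {0}"
  proof (intro equalityI subsetI)
    fix x assume "x \<in> (\<lambda>(i, t). (\<alpha> ^ N) ^ i * t) ` ({..<e} \<times> C0)"
    then show "x \<in> UNIV - {0}" using \<alpha> by (auto simp: mult_gen_def)
  next
    fix x assume "x \<in> UNIV - {0 :: 'a}"
    then obtain k where k: "x = \<alpha> powi k"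
      using gen by (auto simp: mult_gen_def)
    \<comment> \<open>\<open>v\<close> inverts \<open>N\<close> modulo \<open>e\<close>, so
      \<open>i = v * k mod e\<close> solves \<open>N * i = k\<close> modulo
      \<open>e\<close>.\<close>
    obtain v where v: "[int N * v = 1] (mod int e)"
      using cong_solve_coprime_int[OF coprime_N_e] by blast
    define i where "i = nat ((v * k) mod int e)"
    have i: "int i = (v * k) mod int e" "i < e"
      using e by (simp_all add: i_def nat_less_iff)
    have "[int N * int i = int N * (v * k)] (mod int e)"
      by (simp add: i cong_def mod_mult_right_eq)
    also have "[int N * (v * k) = k] (mod int e)"
      using cong_scalar_right[OF v, of k] by (simp add: mult.assoc)
    finally have "int e dvd k - int N * int i"
      by (meson cong_iff_dvd_diff cong_sym)
    then obtain j where "k = int N * int i + int e * j"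
      by (auto simp: dvd_def algebra_simps)
    then have "x = (\<alpha> ^ N) ^ i * (\<alpha> ^ e) powi j"
      by (simp add: k coset_element)
    with i show "x \<in> (\<lambda>(i, t). (\<alpha> ^ N) ^ i * t) ` ({..<e} \<times> C0)"
      by (auto simp: mult_gen_def image_iff)
  qed
qed

lemma card_C0: "e * card C0 = r - 1"
  using bij_betw_same_card[OF bij_betw_cosets]
  by (simp add: card_cartesian_product card_Diff_singleton card_UNIV)

text \<open>Multiplying \<open>t\<close> by a power of \<open>\<alpha> ^ N\<close> scales the trace
  by a nonzero element of \<open>K\<close>. Hence the \<open>x\<close> with
  \<open>T (b * x) \<noteq> 0\<close> consist of \<open>e\<close> disjoint translates of those lying
  in \<open>C0\<close>.\<close>

lemma card_C0_trace_nonzero: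
  assumes "b \<noteq> 0"
  shows "e * card {t \<in> C0. T (b * t) \<noteq> 0} = nz"
proof -
  have fix_power: "((\<alpha> ^ N) ^ i) ^ q = (\<alpha> ^ N) ^ i" for i
    using alpha_N_in_K by (metis power_commutes power_mult mult.commute)
  have "T (b * ((\<alpha> ^ N) ^ i * t)) = (\<alpha> ^ N) ^ i * T (b * t)" for i t
    using field_trace_mult_fixed[OF fix_power, of m i "b * t"] by (simp add: mult_ac)
  then have T_coset: "T (b * ((\<alpha> ^ N) ^ i * t)) = 0 \<longleftrightarrow> T (b * t) = 0" for i t
    using \<alpha> by simp
  have "bij_betw (\<lambda>(i, t). (\<alpha> ^ N) ^ i * t) ({..<e} \<times> {t \<in> C0. T (b * t) \<noteq> 0})
      ((\<lambda>(i, t). (\<alpha> ^ N) ^ i * t) ` ({..<e} \<times> {t \<in> C0. T (b * t) \<noteq> 0}))"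
    by (rule bij_betw_subset[OF bij_betw_cosets]) auto
  also have "(\<lambda>(i, t). (\<alpha> ^ N) ^ i * t) ` ({..<e} \<times> {t \<in> C0. T (b * t) \<noteq> 0})
      = {x \<in> (\<lambda>(i, t). (\<alpha> ^ N) ^ i * t) ` ({..<e} \<times> C0). T (b * x) \<noteq> 0}"
    using T_coset by (auto simp: image_iff)
  also have "\<dots> = {x. T (b * x) \<noteq> 0}"
    unfolding bij_betw_imp_surj_on[OF bij_betw_cosets] by auto
  finally have "e * card {t \<in> C0. T (b * t) \<noteq> 0} = card {x. T (b * x + 0) \<noteq> 0}"
    by (auto dest: bij_betw_same_card simp: card_cartesian_product)
  then show ?thesis
    by (simp only: card_trace_affine_nonzero[OF assms])
qed

section \<open>The two Lee weights\<close>

text \<open>The weight for \<open>a \<noteq> 0\<close>: in each Gray half, every \<open>t\<close> in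
  \<open>C0\<close> contributes \<open>nz\<close>.\<close>

definition w1 :: nat where "w1 = 2 * (card C0 * nz)"
text \<open>The weight for \<open>a = 0\<close> and \<open>b \<noteq> 0\<close>. The count is
  independent of \<open>b\<close>, so \<open>b = 1\<close> represents it; the factor 1 keeps the
  shape of \<open>card_C0_trace_nonzero\<close>.\<close>

definition w2 :: nat where "w2 = 2 * (r * card {t \<in> C0. T (1 * t) \<noteq> 0})"

lemma e_w1: "e * w1 = 2 * ((r - 1) * nz)"
proof -
  have "e * w1 = 2 * ((e * card C0) * nz)"
    by (simp only: w1_def mult.assoc mult.left_commute[of e])
  then show ?thesis by (simp only: card_C0)
qed

lemma e_w2: "e * w2 = 2 * (r * nz)"
proof -
  have "e * w2 = 2 * (r * (e * card {t \<in> C0. T (1 * t) \<noteq> 0}))"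
    by (simp only: w2_def mult.left_commute[of e])
  then show ?thesis by (simp only: card_C0_trace_nonzero[OF one_neq_zero])
qed

text \<open>After multiplication by \<open>e\<close> the comparison is between
  \<open>(r - 1) * nz\<close> and \<open>r * nz\<close>.\<close>

lemma weights_distinct: "w1 \<noteq> w2" "w1 > 0" "w2 > 0"
proof -
  have "nz > 0" using q_ge_2 by simp
  moreover from this have "(r - 1) * nz < r * nz" using r_ge_2 by simp
  moreover have "(r - 1) * nz > 0" using \<open>nz > 0\<close> r_ge_2 by simp
  ultimately have "0 < e * w1" "e * w1 < e * w2"
    unfolding e_w1 e_w2 by linarith+
  then show "w1 \<noteq> w2" "w1 > 0" "w2 > 0"
    using e by auto
qed

abbreviation c :: "'a dual \<Rightarrow> 'a dual \<Rightarrow> 'a dual" where "c \<equiv> ev q m L"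

lemma card_L: "card L = card C0 * r"
  using card_defining_set_Collect[of \<alpha> e "\<lambda>_ _. True"] by (simp add: card_UNIV)

text \<open>The product with \<open>t + u t'\<close> has components \<open>a t\<close> and
  \<open>a t' + b t\<close>; additivity of the trace merges their sum into
  \<open>a t' + (a + b) t\<close> in the second Gray half.\<close>

lemma lee_weight_ev:
  "lee_weight L (c (Dual a b))
    = (\<Sum>t\<in>C0. card {t'. T (a * t' + b * t) \<noteq> 0})
      + (\<Sum>t\<in>C0. card {t'. T (a * t' + (a + b) * t) \<noteq> 0})"
proof -
  have "lee_weight L (c (Dual a b))
      = card {x \<in> L. T (a * eps x + b * re x) \<noteq> 0}
        + card {x \<in> L. T (a * eps x + (a + b) * re x) \<noteq> 0}"
    unfolding lee_weight_eq[OF finite]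
    by (rule arg_cong2[where f = "(+)"]; rule arg_cong[where f = card])
      (auto simp: ev_def dual_trace_def times_dual_def algebra_simps simp flip: trace_add)
  then show ?thesis
    by (simp only: card_defining_set_Collect[of \<alpha> e "\<lambda>t t'. T (a * t' + b * t) \<noteq> 0"]
        card_defining_set_Collect[of \<alpha> e "\<lambda>t t'. T (a * t' + (a + b) * t) \<noteq> 0"])
qed

lemma lee_weight_ev_unit:
  assumes "a \<noteq> 0"
  shows "lee_weight L (c (Dual a b)) = w1"
  unfolding lee_weight_ev by (simp add: card_trace_affine_nonzero[OF assms] w1_def)

text \<open>With \<open>a = 0\<close> the two halves coincide and no entry depends on
  \<open>t'\<close>, so each \<open>t\<close> contributes either \<open>r\<close> or 0.\<close>

lemma lee_weight_ev_nilpotent: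
  assumes "b \<noteq> 0"
  shows "lee_weight L (c (Dual 0 b)) = w2"
proof -
  have "(\<Sum>t\<in>C0. card {t'::'a. T (b * t) \<noteq> 0}) = (\<Sum>t\<in>C0. if T (b * t) \<noteq> 0 then r else 0)"
    by (intro sum.cong) (auto simp: card_UNIV)
  also have "\<dots> = r * card {t \<in> C0. T (b * t) \<noteq> 0}"
    by (simp add: sum.If_cases Int_def)
  also have "card {t \<in> C0. T (b * t) \<noteq> 0} = card {t \<in> C0. T (1 * t) \<noteq> 0}"
  proof -
    have "e * card {t \<in> C0. T (b * t) \<noteq> 0} = e * card {t \<in> C0. T (1 * t) \<noteq> 0}"
      by (simp only: card_C0_trace_nonzero[OF assms] card_C0_trace_nonzero[OF one_neq_zero])
    then show ?thesis using e by simp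
  qed
  finally show ?thesis
    unfolding lee_weight_ev by (simp add: w2_def)
qed

lemma lee_weight_ev_0: "lee_weight L (c 0) = 0"
  by (simp add: zero_dual_def lee_weight_ev)

lemma lee_weight_ev_cases:
  "lee_weight L (c x) = (if x = 0 then 0 else if re x = 0 then w2 else w1)"
  using lee_weight_ev_0 unfolding zero_dual_def
  by (cases x) (auto simp: lee_weight_ev_unit lee_weight_ev_nilpotent)

lemma dual_trace_diff: "dual_trace q m (x - y :: 'a dual) = dual_trace q m x - dual_trace q m y"
  by (simp add: dual_trace_def minus_dual_def trace_diff)

section \<open>Injectivity of evaluation, the enumerator and the two-weight property\<close>

text \<open>Evaluation is additive, and its kernel is trivial because every nonzero element has a
  codeword of positive weight.\<close>

lemma inj_ev: "inj c"
proof (rule injI)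
  fix x y assume eq: "c x = c y"
  have "dual_trace q m ((x - y) * z) = 0" if "z \<in> L" for z
    using fun_cong[OF eq, of z] that
    by (simp add: ev_def left_diff_distrib dual_trace_diff)
  then have "c (x - y) = c 0"
    by (auto simp: ev_def dual_trace_def fun_eq_iff zero_dual_def times_dual_def restrict_def)
  then have "lee_weight L (c (x - y)) = 0"
    by (simp add: lee_weight_ev_0)
  then show "x = y"
    using weights_distinct by (auto simp: lee_weight_ev_cases split: if_splits)
qed

lemma ev_0: "c 0 = (\<lambda>i\<in>L. 0)"
  by (auto simp: ev_def dual_trace_def zero_dual_def times_dual_def)

lemma card_dual: "card {x :: 'a dual. P (re x) (eps x)} = card {(a, b). P a b}"
proof -
  have "bij_betw (\<lambda>x. (re x, eps x)) {x :: 'a dual. P (re x) (eps x)} {(a, b). P a b}"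
    by (rule bij_betw_byWitness[where f' = "\<lambda>(a, b). Dual a b"]) auto
  then show ?thesis by (rule bij_betw_same_card)
qed

lemma card_units: "card {x :: 'a dual. re x \<noteq> 0} = (r - 1) * r"
proof -
  have "{(a :: 'a, b :: 'a). a \<noteq> 0} = (UNIV - {0}) \<times> UNIV" by auto
  then show ?thesis
    using card_dual[of "\<lambda>a _. a \<noteq> 0"]
    by (simp add: card_cartesian_product card_Diff_singleton card_UNIV)
qed

lemma card_nilpotents: "card {x :: 'a dual. re x = 0 \<and> x \<noteq> 0} = r - 1"
proof -
  have "{(a :: 'a, b :: 'a). a = 0 \<and> b \<noteq> 0} = {0} \<times> (UNIV - {0})" by auto
  moreover have "{x :: 'a dual. re x = 0 \<and> x \<noteq> 0} = {x. re x = 0 \<and> eps x \<noteq> 0}"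
    by (auto simp: zero_dual_def dual.expand)
  ultimately show ?thesis
    using card_dual[of "\<lambda>a b. a = 0 \<and> b \<noteq> 0"]
    by (simp add: card_cartesian_product card_Diff_singleton card_UNIV)
qed

lemma dual_partition:
  "(UNIV :: 'a dual set) = {0} \<union> ({x. re x \<noteq> 0} \<union> {x. re x = 0 \<and> x \<noteq> 0})"
  by auto

lemma card_UNIV_dual: "card (UNIV :: 'a dual set) = r\<^sup>2"
proof -
  have "card (UNIV :: ('a \<times> 'a) set) = r * r"
    by (simp add: card_cartesian_product card_UNIV flip: UNIV_Times_UNIV)
  then show ?thesis
    using card_dual[of "\<lambda>_ _. True"] by (simp add: power2_eq_square)
qed

lemma enumerator:
  "lee_weight_enumerator L (range c)
    = 1 + monom ((int r)\<^sup>2 - int r) w1 + monom (int r - 1) w2"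
proof -
  let ?f = "\<lambda>x. monom (1::int) (lee_weight L (c x))"
  have "lee_weight_enumerator L (range c) = (\<Sum>x\<in>UNIV. ?f x)"
    by (simp add: lee_weight_enumerator_def sum.reindex[OF inj_ev])
  \<comment> \<open>The ring splits into zero, the units and the nonzero multiples of
    \<open>u\<close>; the weight is constant on each class.\<close>
  also have "\<dots> = ?f 0 + ((\<Sum>x | re x \<noteq> 0. ?f x) + (\<Sum>x | re x = 0 \<and> x \<noteq> 0. ?f x))"
  proof -
    have "(\<Sum>x\<in>{x. re x \<noteq> 0} \<union> {x. re x = 0 \<and> x \<noteq> 0}. ?f x)
        = (\<Sum>x | re x \<noteq> 0. ?f x) + (\<Sum>x | re x = 0 \<and> x \<noteq> 0. ?f x)"
      by (rule sum.union_disjoint) auto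
    then show ?thesis
      by (subst dual_partition, subst sum.union_disjoint) (auto simp: zero_dual_def)
  qed
  also have "(\<Sum>x | re x \<noteq> 0. ?f x) = (\<Sum>x::'a dual | re x \<noteq> 0. monom 1 w1)"
    by (intro sum.cong) (auto simp: lee_weight_ev_cases zero_dual_def)
  also have "(\<Sum>x | re x = 0 \<and> x \<noteq> 0. ?f x) = (\<Sum>x::'a dual | re x = 0 \<and> x \<noteq> 0. monom 1 w2)"
    by (intro sum.cong) (auto simp: lee_weight_ev_cases)
  also have "(\<Sum>x::'a dual | re x \<noteq> 0. monom (1::int) w1) = monom ((int r)\<^sup>2 - int r) w1"
    using r_ge_2
    by (simp add: card_units of_nat_monom smult_monom mult_monom of_nat_diff algebra_simps
        power2_eq_square)
  also have "(\<Sum>x::'a dual | re x = 0 \<and> x \<noteq> 0. monom (1::int) w2) = monom (int r - 1) w2"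
    using r_ge_2
    by (simp add: card_nilpotents of_nat_monom mult_monom of_nat_diff algebra_simps)
  finally show ?thesis
    by (simp add: lee_weight_ev_0 monom_0 add.assoc)
qed

lemma two_weight: "lee_t_weight_code 2 L (range c)"
proof -
  have "range c - {\<lambda>i\<in>L. 0} = c ` (UNIV - {0})"
    unfolding ev_0[symmetric] using inj_ev by (auto dest: injD)
  then have "lee_weight L ` (range c - {\<lambda>i\<in>L. 0}) = (\<lambda>x. lee_weight L (c x)) ` (UNIV - {0})"
    by (simp add: image_image)
  also have "\<dots> = {w1, w2}"
  proof (intro equalityI subsetI)
    fix w assume "w \<in> {w1, w2}"
    \<comment> \<open>The elements 1 and \<open>u\<close> show that both weights occur.\<close>
    moreover have "w1 = lee_weight L (c (Dual 1 0))" "w2 = lee_weight L (c (Dual 0 1))"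
      by (simp_all add: lee_weight_ev_unit lee_weight_ev_nilpotent)
    ultimately show "w \<in> (\<lambda>x. lee_weight L (c x)) ` (UNIV - {0})"
      by (auto simp: zero_dual_def)
  qed (auto simp: lee_weight_ev_cases)
  finally show ?thesis
    using weights_distinct by (simp add: lee_t_weight_code_def)
qed

lemma trace_code_in_dual_over: "range c \<subseteq> L \<rightarrow>\<^sub>E dual_over K"
  using trace_in_K by (auto simp: ev_def dual_trace_def dual_over_def)

section \<open>Closed forms over the reals\<close>

lemma real_card_L: "real (card L) = ((real r)\<^sup>2 - real r) / real e"
proof -
  have "real e * real (card L) = real (e * card C0) * real r"
    by (simp add: card_L)
  also have "\<dots> = (real r)\<^sup>2 - real r"
    using r_ge_2 by (simp add: card_C0 of_nat_diff algebra_simps power2_eq_square)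
  finally show ?thesis using e by (simp add: field_simps)
qed

lemma real_nz: "real nz = (real q - 1) * real r / real q"
  using q_ge_2 by (simp add: r_eq of_nat_diff)

text \<open>Division by \<open>e\<close> and \<open>q\<close> is carried out only here, over the
  reals, starting from the division-free identity \<open>e_w1\<close>.\<close>

lemma real_w1: "real w1 = 2 * ((real q - 1) / (real e * real q)) * ((real r)\<^sup>2 - real r)"
proof -
  have "real e * real w1 = 2 * ((real r - 1) * real nz)"
    using arg_cong[OF e_w1, of real] r_ge_2 by (simp add: of_nat_diff)
  then show ?thesis
    unfolding real_nz using e q_ge_2 by (simp add: field_simps power2_eq_square)
qed

lemma real_w2: "real w2 = 2 * ((real q - 1) / (real e * real q)) * (real r)\<^sup>2"
proof -
  have "real e * real w2 = 2 * (real r * real nz)"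
    using arg_cong[OF e_w2, of real] by simp
  then show ?thesis
    unfolding real_nz using e q_ge_2 by (simp add: field_simps power2_eq_square)
qed

end

theorem theorem3p3:
  fixes \<alpha> :: "'a::{field,finite}"
    and K :: "'a set"
    and p s q m r e :: nat
  assumes "prime p" and "s \<ge> 1" and "q = p ^ s"
    and "m \<ge> 1" and "r = q ^ m"
    and "card (UNIV :: 'a set) = r"
    and "is_subfield K" and "card K = q"
    and "\<alpha> \<noteq> 0" and "mult_gen \<alpha> = UNIV - {0}"
    and "e > 0" and "e dvd q - 1" and "gcd e m = 1"
  shows "trace_code \<alpha> q m e \<subseteq> defining_set \<alpha> e \<rightarrow>\<^sub>E dual_over K
    \<and> real (card (defining_set \<alpha> e)) = ((real r)\<^sup>2 - real r) / real e
    \<and> card (trace_code \<alpha> q m e) = r\<^sup>2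
    \<and> (\<exists>w1 w2 :: nat.
           real w1 = 2 * ((real q - 1) / (real e * real q)) * ((real r)\<^sup>2 - real r)
         \<and> real w2 = 2 * ((real q - 1) / (real e * real q)) * (real r)\<^sup>2
         \<and> lee_weight_enumerator (defining_set \<alpha> e) (trace_code \<alpha> q m e)
             = 1 + monom ((int r)\<^sup>2 - int r) w1 + monom (int r - 1) w2)
    \<and> lee_t_weight_code 2 (defining_set \<alpha> e) (trace_code \<alpha> q m e)"
proof -
  interpret trace_code_setting \<alpha> K p s q m r e
    using assms by unfold_locales
  show ?thesis
    unfolding trace_code_def
    using trace_code_in_dual_over real_card_L card_image[OF inj_ev] card_UNIV_dual
      real_w1 real_w2 enumerator two_weight
    by auto
qed

end
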